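(* Let $G$ be a countably infinite group and let $b:G\to(\mathbb{R},+)$ be a nonzero homomorphism. Let $x_0\in F^2(G)$, $y_0\in F^3(G)$, and for $t\ge0$ let $$u(t):=t\cdot S_b(y_0)+\frac{M_t^b(x_0)+M_{-t}^b(x_0)}{2}+\frac{M_t^b(T_b(y_0))-M_{-t}^b(T_b(y_0))}{2i}\in C_r^*(G).$$ Then for every $t\ge0$: If $g\in\ker(b)$, then $\widehat{u(t)}(g)=\widehat{x_0}(g)+t\cdot\widehat{y_0}(g)$. If $g\in G\setminus\ker(b)$, then $\widehat{u(t)}(g)=\cos(tb(g))\,\widehat{x_0}(g)+\dfrac{\sin(tb(g))}{b(g)}\,\widehat{y_0}(g)$.
   Context: $\lambda$ is the left regular representation of $G$ on $\ell^2(G)$, $(\lambda(g)\xi)(h)=\xi(g^{-1}h)$; $\{\delta_h\}_{h\in G}$ is the canonical basis of $\ell^2(G)$ and $e$ is the identity of $G$. $C_r^*(G)$ is the closure of $\mathrm{Span}(\lambda(G))$ in $B(\ell^2(G))$ for the operator norm $\|\cdot\|$. For $x\in C_r^*(G)$, the Fourier transform is $\widehat{x}:=x\delta_e\in\ell^2(G)$, with Fourier coefficients $\widehat{x}(g)$, $g\in G$. A series $\sum_{s\in S}x_s$ in a normed space converges to $x$ if the net of its finite partial sums, indexed by the finite subsets of $S$ directed by inclusion, converges to $x$ (unordered convergence). All series below are understood in this sense with respect to $\|\cdot\|$. $CF(G)$ is the set of $x\in C_r^*(G)$ for which $\sum_{g\in G}\widehat{x}(g)\lambda(g)$ is convergent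 w.r.t. $\|\cdot\|$ (the sum is then necessarily $x$). $\{M_t^b\}_{t\in\mathbb{R}}$ is the one-parameter group of $*$-automorphisms of $C_r^*(G)$ with $M_t^b(\lambda(g))=e^{itb(g)}\lambda(g)$ for all $g\in G$, $t\in\mathbb{R}$; the map $t\mapsto M_t^b(x)$ is norm-continuous for every $x\in C_r^*(G)$. For $n\in\mathbb{N}=\{1,2,\dots\}$, $F^n(G)$ is the set of $x\in C_r^*(G)$ such that, for every $k=0,1,\dots,n$, both $\sum_{g\in G}b(g)^k\widehat{x}(g)\lambda(g)$ and $\sum_{g\notin\ker(b)}b(g)^{-k}\widehat{x}(g)\lambda(g)$ are convergent w.r.t. $\|\cdot\|$ (with $b(g)^0=1$ for all $g$). $T_b:F^1(G)\to C_r^*(G)$ is $T_b(x)=\sum_{g\notin\ker(b)}b(g)^{-1}\widehat{x}(g)\lambda(g)$. $S_b:CF(G)\to C_r^*(G)$ is $S_b(x)=\sum_{g\in\ker(b)}\widehat{x}(g)\lambda(g)$. *)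

theory Defs
  imports "HOL-Analysis.Analysis"
begin

section \<open>The Hilbert space of square-summable complex functions on a set\<close>

typedef 'g ell2 = "{f :: 'g \<Rightarrow> complex. (\<lambda>g. (cmod (f g))\<^sup>2) summable_on UNIV}"
  morphisms ell2_apply Abs_ell2
  by (rule exI[of _ "\<lambda>_. 0"]) simp

setup_lifting type_definition_ell2

lemma ell2_summable: "(\<lambda>g. (cmod (ell2_apply x g))\<^sup>2) summable_on UNIV"
  using ell2_apply[of x] by simp

lemma ell2_eqI: "(\<And>g. ell2_apply x g = ell2_apply y g) \<Longrightarrow> x = y"
  by transfer auto

lemma square_summable_add:
  fixes f h :: "'g \<Rightarrow> complex"
  assumes "(\<lambda>g. (cmod (f g))\<^sup>2) summable_on UNIV" "(\<lambda>g. (cmod (h g))\<^sup>2) summable_on UNIV"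
  shows "(\<lambda>g. (cmod (f g + h g))\<^sup>2) summable_on UNIV"
proof (rule summable_on_comparison_test)
  show "(\<lambda>g. 2 * (cmod (f g))\<^sup>2 + 2 * (cmod (h g))\<^sup>2) summable_on UNIV"
    using assms by (intro summable_on_add summable_on_cmult_right)
  fix g
  have "(cmod (f g + h g))\<^sup>2 \<le> (cmod (f g) + cmod (h g))\<^sup>2"
    by (intro power_mono norm_triangle_ineq) auto
  also have "\<dots> \<le> 2 * (cmod (f g))\<^sup>2 + 2 * (cmod (h g))\<^sup>2"
    using zero_le_power2[of "cmod (f g) - cmod (h g)"]
    by (simp add: power2_eq_square algebra_simps)
  finally show "(cmod (f g + h g))\<^sup>2 \<le> 2 * (cmod (f g))\<^sup>2 + 2 * (cmod (h g))\<^sup>2" .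
qed auto

lemma square_summable_mult:
  fixes f :: "'g \<Rightarrow> complex"
  assumes "(\<lambda>g. (cmod (f g))\<^sup>2) summable_on UNIV"
  shows "(\<lambda>g. (cmod (c * f g))\<^sup>2) summable_on UNIV"
  using summable_on_cmult_right[OF assms, of "(cmod c)\<^sup>2"]
  by (simp add: norm_mult power_mult_distrib)

instantiation ell2 :: (type) real_vector
begin

lift_definition zero_ell2 :: "'a ell2" is "\<lambda>_. 0" by simp

lift_definition plus_ell2 :: "'a ell2 \<Rightarrow> 'a ell2 \<Rightarrow> 'a ell2" is "\<lambda>f h g. f g + h g"
  by (simp add: square_summable_add)

lift_definition uminus_ell2 :: "'a ell2 \<Rightarrow> 'a ell2" is "\<lambda>f g. - f g" by simp

lift_definition minus_ell2 :: "'a ell2 \<Rightarrow> 'a ell2 \<Rightarrow> 'a ell2" is "\<lambda>f h g. f g - h g"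
  subgoal for f h using square_summable_add[of f "\<lambda>g. - h g"] by simp
  done

lift_definition scaleR_ell2 :: "real \<Rightarrow> 'a ell2 \<Rightarrow> 'a ell2" is "\<lambda>r f g. complex_of_real r * f g"
  by (rule square_summable_mult) simp

instance
  by standard (transfer; simp add: algebra_simps fun_eq_iff)+

end

lemma ell2_apply_simps [simp]:
  "ell2_apply 0 g = 0"
  "ell2_apply (x + y) g = ell2_apply x g + ell2_apply y g"
  "ell2_apply (- x) g = - ell2_apply x g"
  "ell2_apply (x - y) g = ell2_apply x g - ell2_apply y g"
  "ell2_apply (r *\<^sub>R x) g = complex_of_real r * ell2_apply x g"
  by (transfer; simp)+

lemma ell2_prod_abs_summable:
  "(\<lambda>g. norm (ell2_apply x g * cnj (ell2_apply y g))) summable_on UNIV"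
proof (rule summable_on_comparison_test)
  show "(\<lambda>g. (cmod (ell2_apply x g))\<^sup>2 + (cmod (ell2_apply y g))\<^sup>2) summable_on UNIV"
    by (intro summable_on_add ell2_summable)
  fix g
  show "norm (ell2_apply x g * cnj (ell2_apply y g))
      \<le> (cmod (ell2_apply x g))\<^sup>2 + (cmod (ell2_apply y g))\<^sup>2"
    using sum_squares_bound[of "cmod (ell2_apply x g)" "cmod (ell2_apply y g)"]
      mult_nonneg_nonneg[OF norm_ge_zero norm_ge_zero, of "ell2_apply x g" "ell2_apply y g"]
    unfolding norm_mult complex_mod_cnj by linarith
qed auto

lemma ell2_prod_summable:
  "(\<lambda>g. ell2_apply x g * cnj (ell2_apply y g)) summable_on UNIV"
  by (rule abs_summable_summable[OF ell2_prod_abs_summable])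

definition cinner :: "'g ell2 \<Rightarrow> 'g ell2 \<Rightarrow> complex" where
  "cinner x y = (\<Sum>\<^sub>\<infinity>g. ell2_apply x g * cnj (ell2_apply y g))"

lemma cinner_add_left: "cinner (x + y) z = cinner x z + cinner y z"
  unfolding cinner_def by (simp add: distrib_right infsum_add ell2_prod_summable)

lemma cinner_cnj: "cnj (cinner x y) = cinner y x"
  unfolding cinner_def infsum_cnj[symmetric] by (simp add: mult.commute)

lemma cinner_scaleR_left: "cinner (r *\<^sub>R x) y = complex_of_real r * cinner x y"
  unfolding cinner_def by (simp add: mult.assoc infsum_cmult_right')

lemma cinner_self: "cinner x x = complex_of_real (\<Sum>\<^sub>\<infinity>g. (cmod (ell2_apply x g))\<^sup>2)"
proof -
  have "((\<lambda>g. complex_of_real ((cmod (ell2_apply x g))\<^sup>2))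
      has_sum complex_of_real (\<Sum>\<^sub>\<infinity>g. (cmod (ell2_apply x g))\<^sup>2)) UNIV"
    by (intro has_sum_of_real has_sum_infsum ell2_summable)
  then show ?thesis
    unfolding cinner_def complex_norm_square by (rule infsumI)
qed

instantiation ell2 :: (type) real_inner
begin

definition inner_ell2 :: "'a ell2 \<Rightarrow> 'a ell2 \<Rightarrow> real" where
  "inner_ell2 x y = Re (cinner x y)"

definition norm_ell2 :: "'a ell2 \<Rightarrow> real" where
  "norm_ell2 x = sqrt (\<Sum>\<^sub>\<infinity>g. (cmod (ell2_apply x g))\<^sup>2)"

definition dist_ell2 :: "'a ell2 \<Rightarrow> 'a ell2 \<Rightarrow> real" where
  "dist_ell2 x y = norm (x - y)"

definition sgn_ell2 :: "'a ell2 \<Rightarrow> 'a ell2" where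
  "sgn_ell2 x = inverse (norm x) *\<^sub>R x"

definition uniformity_ell2 :: "('a ell2 \<times> 'a ell2) filter" where
  "uniformity_ell2 = (INF e\<in>{0<..}. principal {(x, y). dist x y < e})"

definition open_ell2 :: "'a ell2 set \<Rightarrow> bool" where
  "open_ell2 U \<longleftrightarrow> (\<forall>x\<in>U. \<forall>\<^sub>F (x', y) in uniformity. x' = x \<longrightarrow> y \<in> U)"

instance
proof
  fix x y z :: "'a ell2" and r :: real
  show "inner x y = inner y x"
    unfolding inner_ell2_def by (metis cinner_cnj cnj.sel(1))
  show "inner (x + y) z = inner x z + inner y z"
    by (simp add: inner_ell2_def cinner_add_left)
  show "inner (r *\<^sub>R x) y = r * inner x y"
    by (simp add: inner_ell2_def cinner_scaleR_left)
  show "0 \<le> inner x x"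
    by (simp add: inner_ell2_def cinner_self infsum_nonneg)
  show "inner x x = 0 \<longleftrightarrow> x = 0"
  proof
    assume "inner x x = 0"
    then have "(\<Sum>\<^sub>\<infinity>g. (cmod (ell2_apply x g))\<^sup>2) \<le> 0"
      by (simp add: inner_ell2_def cinner_self)
    then have "(cmod (ell2_apply x g))\<^sup>2 = 0" for g
      using nonneg_infsum_le_0D[OF _ ell2_summable] by simp
    then show "x = 0" by (intro ell2_eqI) simp
  qed (simp add: inner_ell2_def cinner_self)
  show "norm x = sqrt (inner x x)"
    by (simp add: inner_ell2_def cinner_self norm_ell2_def)
qed (rule dist_ell2_def sgn_ell2_def uniformity_ell2_def open_ell2_def)+

end

lemma norm_ell2_le_iff:
  assumes "c \<ge> 0"
  shows "norm x \<le> c \<longleftrightarrow> (\<forall>F. finite F \<longrightarrow> (\<Sum>g\<in>F. (cmod (ell2_apply x g))\<^sup>2) \<le> c\<^sup>2)"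
proof
  assume "norm x \<le> c"
  then have "(\<Sum>\<^sub>\<infinity>g. (cmod (ell2_apply x g))\<^sup>2) \<le> c\<^sup>2"
    by (simp add: norm_ell2_def sqrt_le_D)
  then show "\<forall>F. finite F \<longrightarrow> (\<Sum>g\<in>F. (cmod (ell2_apply x g))\<^sup>2) \<le> c\<^sup>2"
    using finite_sum_le_infsum[OF ell2_summable, of _ x] by (meson order_trans subset_UNIV zero_le_power2)
next
  assume "\<forall>F. finite F \<longrightarrow> (\<Sum>g\<in>F. (cmod (ell2_apply x g))\<^sup>2) \<le> c\<^sup>2"
  then have "(\<Sum>\<^sub>\<infinity>g. (cmod (ell2_apply x g))\<^sup>2) \<le> c\<^sup>2"
    by (intro infsum_le_finite_sums ell2_summable) auto
  then show "norm x \<le> c"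
    using assms by (simp add: norm_ell2_def real_le_lsqrt infsum_nonneg)
qed

lemma ell2_apply_le_norm: "cmod (ell2_apply x g) \<le> norm x"
proof -
  have "(\<Sum>h\<in>{g}. (cmod (ell2_apply x h))\<^sup>2) \<le> (norm x)\<^sup>2"
    using norm_ell2_le_iff[of "norm x" x] by (metis finite.emptyI finite_insert norm_ge_zero order_refl)
  then show ?thesis by (simp add: abs_le_square_iff[symmetric])
qed

instance ell2 :: (type) banach
proof
  fix X :: "nat \<Rightarrow> 'a ell2"
  assume X: "Cauchy X"
  have "Cauchy (\<lambda>n. ell2_apply (X n) g)" for g
  proof (rule CauchyI)
    fix e :: real assume "e > 0"
    then obtain N where "\<forall>m\<ge>N. \<forall>n\<ge>N. norm (X m - X n) < e"
      using CauchyD[OF X] by blast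
    then show "\<exists>N. \<forall>m\<ge>N. \<forall>n\<ge>N. norm (ell2_apply (X m) g - ell2_apply (X n) g) < e"
      using ell2_apply_le_norm[of "X _ - X _" g] by (metis ell2_apply_simps(4) order_le_less_trans)
  qed
  then have lim: "(\<lambda>n. ell2_apply (X n) g) \<longlonglongrightarrow> lim (\<lambda>n. ell2_apply (X n) g)" for g
    by (simp add: Cauchy_convergent_iff convergent_LIMSEQ_iff)
  define f where "f = (\<lambda>g. lim (\<lambda>n. ell2_apply (X n) g))"
  have lim: "(\<lambda>n. ell2_apply (X n) g) \<longlonglongrightarrow> f g" for g
    using lim f_def by simp
  have tail: "(\<Sum>g\<in>F. (cmod (ell2_apply (X n) g - f g))\<^sup>2) \<le> e\<^sup>2"
    if N: "\<forall>m\<ge>N. \<forall>n\<ge>N. norm (X m - X n) < e" and n: "n \<ge> N" and F: "finite F" for e N n F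
  proof (rule LIMSEQ_le_const2)
    show "(\<lambda>m. \<Sum>g\<in>F. (cmod (ell2_apply (X n) g - ell2_apply (X m) g))\<^sup>2)
        \<longlonglongrightarrow> (\<Sum>g\<in>F. (cmod (ell2_apply (X n) g - f g))\<^sup>2)"
      by (intro tendsto_intros lim)
    have "(\<Sum>g\<in>F. (cmod (ell2_apply (X n) g - ell2_apply (X m) g))\<^sup>2) \<le> e\<^sup>2" if "m \<ge> N" for m
    proof -
      have *: "norm (X n - X m) < e" using N n that by blast
      moreover have "0 \<le> e" using * norm_ge_zero[of "X n - X m"] by linarith
      ultimately show ?thesis using norm_ell2_le_iff[of e "X n - X m"] F by simp
    qed
    then show "\<exists>M. \<forall>m\<ge>M. (\<Sum>g\<in>F. (cmod (ell2_apply (X n) g - ell2_apply (X m) g))\<^sup>2) \<le> e\<^sup>2"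
      by blast
  qed
  have sq: "(\<lambda>g. (cmod (f g))\<^sup>2) summable_on UNIV"
  proof -
    obtain N where N: "\<forall>m\<ge>N. \<forall>n\<ge>N. norm (X m - X n) < 1"
      using CauchyD[OF X, of 1] by auto
    have "(\<lambda>g. (cmod (ell2_apply (X N) g - f g))\<^sup>2) summable_on UNIV"
      using tail[OF N order_refl]
      by (intro nonneg_bdd_above_summable_on) (auto simp: bdd_above_def)
    then have "(\<lambda>g. (cmod (- 1 * (ell2_apply (X N) g - f g)))\<^sup>2) summable_on UNIV"
      by (rule square_summable_mult)
    then have "(\<lambda>g. (cmod (ell2_apply (X N) g + - 1 * (ell2_apply (X N) g - f g)))\<^sup>2) summable_on UNIV"
      by (rule square_summable_add[OF ell2_summable])
    then show ?thesis by simp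
  qed
  define L where "L = Abs_ell2 f"
  have L: "ell2_apply L g = f g" for g
    unfolding L_def using sq by (simp add: Abs_ell2_inverse)
  have "X \<longlonglongrightarrow> L"
  proof (rule LIMSEQ_I)
    fix e :: real assume e: "e > 0"
    then obtain N where N: "\<forall>m\<ge>N. \<forall>n\<ge>N. norm (X m - X n) < e / 2"
      using CauchyD[OF X, of "e / 2"] by auto
    have "norm (X n - L) < e" if "n \<ge> N" for n
    proof -
      have "norm (X n - L) \<le> e / 2"
        using e tail[OF N that] by (subst norm_ell2_le_iff) (auto simp: L)
      then show ?thesis using e by simp
    qed
    then show "\<exists>N. \<forall>n\<ge>N. norm (X n - L) < e" by blast
  qed
  then show "convergent X" by (auto simp: convergent_def)
qed

lift_definition cscale :: "complex \<Rightarrow> 'g ell2 \<Rightarrow> 'g ell2" is "\<lambda>c f g. c * f g"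
  by (rule square_summable_mult) simp

lift_definition delta :: "'g \<Rightarrow> 'g ell2" is "\<lambda>h g. if g = h then 1 else 0"
  by (rule finite_nonzero_values_imp_summable_on) simp

lemma ell2_apply_cscale [simp]: "ell2_apply (cscale c x) g = c * ell2_apply x g"
  by transfer simp

lemma ell2_apply_delta: "ell2_apply (delta h) g = (if g = h then 1 else 0)"
  by transfer simp

lemma norm_cscale: "norm (cscale c x) = cmod c * norm x"
  unfolding norm_ell2_def
  by (simp add: norm_mult power_mult_distrib infsum_cmult_right' real_sqrt_mult)

lemma bounded_linear_cscale: "bounded_linear (cscale c)"
  by (rule bounded_linear_intro[where K = "cmod c"])
    (auto intro!: ell2_eqI simp: algebra_simps norm_cscale)

lemma cinner_cscale_left: "cinner (cscale c x) y = c * cinner x y"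
  unfolding cinner_def by (simp add: mult.assoc infsum_cmult_right')


section \<open>Operators, the left regular representation and the reduced group C*-algebra\<close>

text \<open>
  Operators are elements of \<^typ>\<open>'g ell2 \<Rightarrow>\<^sub>L 'g ell2\<close>, the real-linear bounded operators with the
  operator norm. The complex-linear ones form a norm-closed subspace on which the operator
  norm is the usual one; it contains all left translations and is closed under
  \<open>op_scale\<close>, so closures of complex spans of left translations and limits of series of
  such elements are the same in this space as in the complex-linear operators.
\<close>

definition op_scale ::
  "complex \<Rightarrow> ('g ell2 \<Rightarrow>\<^sub>L 'g ell2) \<Rightarrow> ('g ell2 \<Rightarrow>\<^sub>L 'g ell2)" where
  "op_scale c A = Blinfun (\<lambda>x. cscale c (A x))"

lemma op_scale_apply [simp]: "blinfun_apply (op_scale c A) x = cscale c (A x)"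
  unfolding op_scale_def
  by (simp add: bounded_linear_Blinfun_apply
      bounded_linear_compose[OF bounded_linear_cscale blinfun.bounded_linear_right])

global_interpretation ell2_op: vector_space "op_scale :: complex \<Rightarrow> ('g ell2 \<Rightarrow>\<^sub>L 'g ell2) \<Rightarrow> _"
  defines op_span = ell2_op.span
  by standard (auto intro!: blinfun_eqI ell2_eqI simp: blinfun.add_left algebra_simps)

text \<open>
  Groups are elements of \<^class>\<open>group_add\<close>, which does not assume commutativity: the product
  is \<^term>\<open>g + h\<close>, the inverse \<^term>\<open>- g\<close> and the identity \<^term>\<open>0\<close>.
\<close>

lemma shift_square_infsum:
  fixes g :: "'g::group_add" and f :: "'g \<Rightarrow> complex"
  shows "(\<lambda>h. (cmod (f (- g + h)))\<^sup>2) summable_on UNIV \<longleftrightarrow> (\<lambda>h. (cmod (f h))\<^sup>2) summable_on UNIV"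
    and "(\<Sum>\<^sub>\<infinity>h. (cmod (f (- g + h)))\<^sup>2) = (\<Sum>\<^sub>\<infinity>h. (cmod (f h))\<^sup>2)"
proof -
  have bij: "bij_betw (\<lambda>h. - g + h) UNIV UNIV"
    by (rule bij_betwI[where g = "\<lambda>h. g + h"]) (auto simp: add.assoc[symmetric])
  show "(\<lambda>h. (cmod (f (- g + h)))\<^sup>2) summable_on UNIV \<longleftrightarrow> (\<lambda>h. (cmod (f h))\<^sup>2) summable_on UNIV"
    using summable_on_reindex_bij_betw[OF bij, of "\<lambda>h. (cmod (f h))\<^sup>2"] by simp
  show "(\<Sum>\<^sub>\<infinity>h. (cmod (f (- g + h)))\<^sup>2) = (\<Sum>\<^sub>\<infinity>h. (cmod (f h))\<^sup>2)"
    using infsum_reindex_bij_betw[OF bij, of "\<lambda>h. (cmod (f h))\<^sup>2"] by simp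
qed

lift_definition translate :: "'g::group_add \<Rightarrow> 'g ell2 \<Rightarrow> 'g ell2" is "\<lambda>g f h. f (- g + h)"
  by (simp add: shift_square_infsum)

lemma ell2_apply_translate [simp]: "ell2_apply (translate g x) h = ell2_apply x (- g + h)"
  by transfer simp

lemma norm_translate: "norm (translate g x) = norm x"
  unfolding norm_ell2_def by (simp add: shift_square_infsum)

lemma bounded_linear_translate: "bounded_linear (translate g)"
  by (rule bounded_linear_intro[where K = 1]) (auto intro!: ell2_eqI simp: norm_translate)

definition lreg :: "'g::group_add \<Rightarrow> ('g ell2 \<Rightarrow>\<^sub>L 'g ell2)" where
  "lreg g = Blinfun (translate g)"

lemma lreg_apply [simp]: "ell2_apply (lreg g x) h = ell2_apply x (- g + h)"
  by (simp add: lreg_def bounded_linear_Blinfun_apply bounded_linear_translate)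

definition Cred :: "('g::group_add ell2 \<Rightarrow>\<^sub>L 'g ell2) set" where
  "Cred = closure (op_span (range lreg))"

definition fourier :: "('g::group_add ell2 \<Rightarrow>\<^sub>L 'g ell2) \<Rightarrow> 'g \<Rightarrow> complex" where
  "fourier x = ell2_apply (blinfun_apply x (delta 0))"


section \<open>The flow, the function spaces and the operators attached to a homomorphism\<close>

definition is_adjoint :: "('g ell2 \<Rightarrow>\<^sub>L 'g ell2) \<Rightarrow> ('g ell2 \<Rightarrow>\<^sub>L 'g ell2) \<Rightarrow> bool" where
  "is_adjoint A B \<longleftrightarrow> (\<forall>\<xi> \<eta>. cinner (A \<xi>) \<eta> = cinner \<xi> (B \<eta>))"

definition star_automorphism ::
  "(('g::group_add ell2 \<Rightarrow>\<^sub>L 'g ell2) \<Rightarrow> ('g ell2 \<Rightarrow>\<^sub>L 'g ell2)) \<Rightarrow> bool" where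
  "star_automorphism \<phi> \<longleftrightarrow>
     bij_betw \<phi> Cred Cred \<and>
     (\<forall>x\<in>Cred. \<forall>y\<in>Cred. \<phi> (x + y) = \<phi> x + \<phi> y) \<and>
     (\<forall>c. \<forall>x\<in>Cred. \<phi> (op_scale c x) = op_scale c (\<phi> x)) \<and>
     (\<forall>x\<in>Cred. \<forall>y\<in>Cred. \<phi> (x o\<^sub>L y) = \<phi> x o\<^sub>L \<phi> y) \<and>
     (\<forall>x\<in>Cred. \<forall>y\<in>Cred. is_adjoint x y \<longrightarrow> is_adjoint (\<phi> x) (\<phi> y))"

text \<open>
  \<open>is_flow b M\<close> says that \<open>M\<close> is the one-parameter group of *-automorphisms given on
  the generators by \<open>b\<close>. Only the restriction of each \<open>M t\<close> to \<^const>\<open>Cred\<close> is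
  constrained. There it is unique, since *-automorphisms are contractive and the span of the
  left translations is dense; existence is lemma \<open>flow_exists\<close> below.
\<close>
definition is_flow ::
  "('g::group_add \<Rightarrow> real) \<Rightarrow> (real \<Rightarrow> ('g ell2 \<Rightarrow>\<^sub>L 'g ell2) \<Rightarrow> ('g ell2 \<Rightarrow>\<^sub>L 'g ell2)) \<Rightarrow> bool" where
  "is_flow b M \<longleftrightarrow>
     (\<forall>t. star_automorphism (M t)) \<and>
     (\<forall>x\<in>Cred. M 0 x = x) \<and>
     (\<forall>s t. \<forall>x\<in>Cred. M (s + t) x = M s (M t x)) \<and>
     (\<forall>t g. M t (lreg g) = op_scale (exp (\<i> * of_real (t * b g))) (lreg g)) \<and>
     (\<forall>x\<in>Cred. continuous_on UNIV (\<lambda>t. M t x))"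

definition hom_kernel :: "('g::group_add \<Rightarrow> real) \<Rightarrow> 'g set" where
  "hom_kernel b = {g. b g = 0}"

text \<open>
  The library's \<open>summable_on\<close> and \<open>infsum\<close> are convergence and limit of the net of
  finite partial sums; on \<^typ>\<open>'g ell2 \<Rightarrow>\<^sub>L 'g ell2\<close> the topology is that of the operator norm.
\<close>

definition CF :: "('g::group_add ell2 \<Rightarrow>\<^sub>L 'g ell2) set" where
  "CF = {x \<in> Cred. (\<lambda>g. op_scale (fourier x g) (lreg g)) summable_on UNIV}"

definition Fspace :: "nat \<Rightarrow> ('g::group_add \<Rightarrow> real) \<Rightarrow> ('g ell2 \<Rightarrow>\<^sub>L 'g ell2) set" where
  "Fspace n b = {x \<in> Cred. \<forall>k\<le>n.
     (\<lambda>g. op_scale (of_real (b g ^ k) * fourier x g) (lreg g)) summable_on UNIV \<and>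
     (\<lambda>g. op_scale (of_real (inverse (b g ^ k)) * fourier x g) (lreg g))
        summable_on (UNIV - hom_kernel b)}"

text \<open>
  The domains of \<open>Tb b\<close> and \<open>Sb b\<close> are \<^term>\<open>Fspace 1 b\<close> and \<^const>\<open>CF\<close>; elsewhere the
  values carry no meaning.
\<close>

definition Tb :: "('g::group_add \<Rightarrow> real) \<Rightarrow> ('g ell2 \<Rightarrow>\<^sub>L 'g ell2) \<Rightarrow> ('g ell2 \<Rightarrow>\<^sub>L 'g ell2)" where
  "Tb b x = (\<Sum>\<^sub>\<infinity>g\<in>UNIV - hom_kernel b. op_scale (of_real (inverse (b g)) * fourier x g) (lreg g))"

definition Sb :: "('g::group_add \<Rightarrow> real) \<Rightarrow> ('g ell2 \<Rightarrow>\<^sub>L 'g ell2) \<Rightarrow> ('g ell2 \<Rightarrow>\<^sub>L 'g ell2)" where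
  "Sb b x = (\<Sum>\<^sub>\<infinity>g\<in>hom_kernel b. op_scale (fourier x g) (lreg g))"

lemma Fspace_mono: "m \<le> n \<Longrightarrow> Fspace n b \<subseteq> Fspace m b"
  unfolding Fspace_def by auto

lemma Fspace_subset_CF: "Fspace n b \<subseteq> CF"
proof
  fix x assume "x \<in> Fspace n b"
  then have "x \<in> Fspace 0 b" using Fspace_mono[of 0 n b] by auto
  then show "x \<in> CF" by (simp add: Fspace_def CF_def)
qed

lemma lreg_series_in_Cred: "(\<Sum>\<^sub>\<infinity>g\<in>S. op_scale (c g) (lreg g)) \<in> Cred"
proof (cases "(\<lambda>g. op_scale (c g) (lreg g)) summable_on S")
  case True
  have fin: "(\<Sum>g\<in>F. op_scale (c g) (lreg g)) \<in> Cred" for F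
    unfolding Cred_def
    by (intro subsetD[OF closure_subset] ell2_op.span_sum ell2_op.span_scale ell2_op.span_base rangeI)
  have "(sum (\<lambda>g. op_scale (c g) (lreg g)) \<longlongrightarrow> (\<Sum>\<^sub>\<infinity>g\<in>S. op_scale (c g) (lreg g)))
      (finite_subsets_at_top S)"
    using True by (rule infsum_tendsto)
  then show ?thesis
    using fin by (intro Lim_in_closed_set[of Cred]) (auto simp: Cred_def)
next
  case False
  have "0 \<in> op_span (range lreg :: ('g::group_add ell2 \<Rightarrow>\<^sub>L 'g ell2) set)"
    by (rule ell2_op.span_zero)
  then show ?thesis
    using False closure_subset by (auto simp: infsum_not_exists Cred_def)
qed

lemma Tb_in_Cred: "Tb b x \<in> Cred" and Sb_in_Cred: "Sb b x \<in> Cred"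
  unfolding Tb_def Sb_def by (rule lreg_series_in_Cred)+



subsection \<open>Existence of the flow\<close>

lift_definition modulate :: "('g \<Rightarrow> real) \<Rightarrow> 'g ell2 \<Rightarrow> 'g ell2" is "\<lambda>c f g. cis (c g) * f g"
  by (simp add: norm_mult)

lemma ell2_apply_modulate [simp]: "ell2_apply (modulate c x) g = cis (c g) * ell2_apply x g"
  by transfer simp

lemma norm_modulate: "norm (modulate c x) = norm x"
  unfolding norm_ell2_def by (simp add: norm_mult)

lemma bounded_linear_modulate: "bounded_linear (modulate c)"
  by (rule bounded_linear_intro[where K = 1])
    (auto intro!: ell2_eqI simp: norm_modulate algebra_simps)

definition phase :: "('g \<Rightarrow> real) \<Rightarrow> ('g ell2 \<Rightarrow>\<^sub>L 'g ell2)" where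
  "phase c = Blinfun (modulate c)"

lemma phase_apply: "blinfun_apply (phase c) x = modulate c x"
  by (simp add: phase_def bounded_linear_Blinfun_apply bounded_linear_modulate)

lemma norm_phase_le: "norm (phase c) \<le> 1"
  by (rule norm_blinfun_bound) (simp_all add: phase_apply norm_modulate)

lemma modulate_modulate: "modulate c (modulate d x) = modulate (\<lambda>g. c g + d g) x"
  by (rule ell2_eqI) (simp add: cis_mult mult.assoc[symmetric])

lemma modulate_zero: "modulate (\<lambda>g. 0) x = x"
  by (rule ell2_eqI) simp

lemma cinner_modulate: "cinner (modulate c x) y = cinner x (modulate (\<lambda>g. - c g) y)"
  unfolding cinner_def by (simp add: cis_cnj mult_ac)

definition conj_flow ::
  "('g::group_add \<Rightarrow> real) \<Rightarrow> real \<Rightarrow> ('g ell2 \<Rightarrow>\<^sub>L 'g ell2) \<Rightarrow> ('g ell2 \<Rightarrow>\<^sub>L 'g ell2)" where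
  "conj_flow b t x = phase (\<lambda>g. t * b g) o\<^sub>L x o\<^sub>L phase (\<lambda>g. - t * b g)"

lemma conj_flow_apply:
  "blinfun_apply (conj_flow b t x) \<xi> = modulate (\<lambda>g. t * b g) (x (modulate (\<lambda>g. - t * b g) \<xi>))"
  by (simp add: conj_flow_def phase_apply)

lemma conj_flow_diff: "conj_flow b t x - conj_flow b t y = conj_flow b t (x - y)"
  by (intro blinfun_eqI ell2_eqI) (simp add: conj_flow_apply blinfun.diff_left algebra_simps)

lemma conj_flow_add: "conj_flow b t (x + y) = conj_flow b t x + conj_flow b t y"
  by (intro blinfun_eqI ell2_eqI) (simp add: conj_flow_apply blinfun.add_left algebra_simps)

lemma conj_flow_scale: "conj_flow b t (op_scale c x) = op_scale c (conj_flow b t x)"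
  by (intro blinfun_eqI ell2_eqI) (simp add: conj_flow_apply)

lemma conj_flow_zero: "conj_flow b 0 x = x"
  by (intro blinfun_eqI) (simp add: conj_flow_apply modulate_zero)

lemma conj_flow_conj_flow: "conj_flow b s (conj_flow b t x) = conj_flow b (s + t) x"
  by (intro blinfun_eqI) (simp add: conj_flow_apply modulate_modulate algebra_simps)

lemma conj_flow_compose: "conj_flow b t (x o\<^sub>L y) = conj_flow b t x o\<^sub>L conj_flow b t y"
  by (intro blinfun_eqI) (simp add: conj_flow_apply modulate_modulate modulate_zero)

lemma conj_flow_adjoint: "is_adjoint x y \<Longrightarrow> is_adjoint (conj_flow b t x) (conj_flow b t y)"
  unfolding is_adjoint_def conj_flow_apply by (simp add: cinner_modulate)

lemma norm_conj_flow_le: "norm (conj_flow b t x) \<le> norm x"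
proof -
  have "norm (conj_flow b t x) \<le> norm (phase (\<lambda>g. t * b g) o\<^sub>L x) * norm (phase (\<lambda>g. - t * b g))"
    unfolding conj_flow_def by (rule norm_blinfun_compose)
  also have "\<dots> \<le> norm (phase (\<lambda>g. t * b g) o\<^sub>L x) * 1"
    by (intro mult_left_mono norm_phase_le) simp
  also have "\<dots> \<le> norm (phase (\<lambda>g. t * b g)) * norm x"
    by (simp add: norm_blinfun_compose)
  also have "\<dots> \<le> 1 * norm x"
    by (intro mult_right_mono norm_phase_le) simp
  finally show ?thesis by simp
qed

lemma conj_flow_lreg:
  assumes hom: "\<forall>g h. b (g + h) = b g + b h"
  shows "conj_flow b t (lreg g) = op_scale (exp (\<i> * of_real (t * b g))) (lreg g)"
proof (intro blinfun_eqI ell2_eqI)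
  fix \<xi> h
  have "b h = b g + b (- g + h)" using hom[rule_format, of g "- g + h"] by (simp add: add.assoc[symmetric])
  then have "cis (t * b h) * cis (- (t * b (- g + h))) = cis (t * b g)"
    by (simp add: cis_mult algebra_simps)
  then show "ell2_apply (conj_flow b t (lreg g) \<xi>) h
      = ell2_apply (op_scale (exp (\<i> * of_real (t * b g))) (lreg g) \<xi>) h"
    unfolding cis_conv_exp[symmetric] by (simp add: conj_flow_apply mult.assoc[symmetric])
qed

lemma bounded_linear_conj_flow: "bounded_linear (conj_flow b t)"
  unfolding conj_flow_def[abs_def]
  by (intro bounded_linear_intros)

lemma bounded_linear_op_scale_left: "bounded_linear (\<lambda>c. op_scale c x)"
proof (rule bounded_linear_intro[where K = "norm x"])
  fix c
  show "norm (op_scale c x) \<le> norm c * norm x"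
    by (rule norm_blinfun_bound)
      (auto simp: norm_cscale mult.assoc intro!: mult_left_mono norm_blinfun)
qed (auto intro!: blinfun_eqI ell2_eqI
      simp: blinfun.add_left blinfun.scaleR_left algebra_simps scaleR_conv_of_real)

lemma conj_flow_span:
  assumes hom: "\<forall>g h. b (g + h) = b g + b h" and x: "x \<in> op_span (range lreg)"
  shows "conj_flow b t x \<in> op_span (range lreg) \<and> continuous_on UNIV (\<lambda>t. conj_flow b t x)"
  using x
proof (induction x rule: ell2_op.span_induct_alt)
  case base
  have "conj_flow b t 0 = 0" for t
    by (rule bounded_linear.linear[OF bounded_linear_conj_flow, THEN linear_0])
  then show ?case by (simp add: ell2_op.span_zero)
next
  case (step c x y)
  then obtain g where g: "x = lreg g" by auto
  have eq: "conj_flow b t (op_scale c x + y)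
      = op_scale c (op_scale (exp (\<i> * of_real (t * b g))) (lreg g)) + conj_flow b t y" for t
    by (simp add: conj_flow_add conj_flow_scale g conj_flow_lreg[OF hom])
  have "continuous_on UNIV (\<lambda>t. op_scale (c * exp (\<i> * of_real (t * b g))) (lreg g) + conj_flow b t y)"
    using step
    by (intro continuous_intros bounded_linear.continuous_on[OF bounded_linear_op_scale_left]) auto
  then have "continuous_on UNIV (\<lambda>t. conj_flow b t (op_scale c x + y))"
    by (simp add: eq)
  moreover have "conj_flow b t (op_scale c x + y) \<in> op_span (range lreg)"
    unfolding eq using step
    by (intro ell2_op.span_add ell2_op.span_scale) (auto intro: ell2_op.span_base)
  ultimately show ?case by blast
qed

lemma conj_flow_Cred:
  assumes hom: "\<forall>g h. b (g + h) = b g + b h" and x: "x \<in> Cred"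
  shows "conj_flow b t x \<in> Cred"
proof -
  have "conj_flow b t ` closure (op_span (range lreg)) \<subseteq> closure (op_span (range lreg))"
    using conj_flow_span[OF hom] closure_subset
    by (intro image_closure_subset linear_continuous_on bounded_linear_conj_flow) auto
  then show ?thesis using x by (auto simp: Cred_def)
qed

lemma conj_flow_continuous:
  assumes hom: "\<forall>g h. b (g + h) = b g + b h" and x: "x \<in> Cred"
  shows "continuous_on UNIV (\<lambda>t. conj_flow b t x)"
proof -
  obtain X where X: "\<And>n. X n \<in> op_span (range lreg)" "X \<longlonglongrightarrow> x"
    using x unfolding Cred_def closure_sequential by blast
  show ?thesis
  proof (rule uniform_limit_theorem[where F = sequentially and f = "\<lambda>n t. conj_flow b t (X n)"])
    show "\<forall>\<^sub>F n in sequentially. continuous_on UNIV (\<lambda>t. conj_flow b t (X n))"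
      using conj_flow_span[OF hom X(1)] by simp
    show "uniform_limit UNIV (\<lambda>n t. conj_flow b t (X n)) (\<lambda>t. conj_flow b t x) sequentially"
    proof (rule uniform_limitI)
      fix e :: real assume "e > 0"
      then have "\<forall>\<^sub>F n in sequentially. dist (X n) x < e" using X(2) tendstoD by blast
      then show "\<forall>\<^sub>F n in sequentially. \<forall>t\<in>UNIV. dist (conj_flow b t (X n)) (conj_flow b t x) < e"
        by eventually_elim
          (auto simp: dist_norm conj_flow_diff intro: le_less_trans[OF norm_conj_flow_le])
    qed
  qed simp
qed

lemma flow_exists:
  assumes hom: "\<forall>g h. b (g + h) = b g + b h"
  shows "\<exists>M. is_flow b M"
proof (intro exI[of _ "conj_flow b"])
  have "bij_betw (conj_flow b t) Cred Cred" for t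
    by (rule bij_betwI[where g = "conj_flow b (- t)"])
      (auto simp: conj_flow_Cred[OF hom] conj_flow_conj_flow conj_flow_zero)
  then show "is_flow b (conj_flow b)"
    unfolding is_flow_def star_automorphism_def
    by (simp add: conj_flow_add conj_flow_scale conj_flow_compose conj_flow_adjoint
        conj_flow_zero conj_flow_conj_flow conj_flow_lreg[OF hom] conj_flow_continuous[OF hom])
qed

end

theory Submission
  imports Defs
begin

text \<open>
  Everything rests on the formula
  \<open>fourier (M t x) g = cis (t * b g) * fourier x g\<close>, valid for every \<open>x\<close> in the reduced
  group C*-algebra (lemma \<open>fourier_flow\<close>). It is immediate when \<open>x\<close> is a finite combination of
  left translations, and Fourier coefficients depend continuously on \<open>x\<close>; the point is to pass
  to norm limits, although \<open>M t\<close> is only given as an algebraic *-automorphism. This requires the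
  automatic contractivity of *-automorphisms (lemma \<open>star_automorphism_norm_le\<close>).

  Contractivity is obtained without spectral theory. If \<open>x\<close> has norm less than \<open>1\<close> and adjoint
  \<open>y\<close>, then \<open>1 - y x\<close> has a self-adjoint square root \<open>k\<close> inside the algebra, so that
  \<open>y x + k\<^sup>2 = 1\<close>. Applying the automorphism to this identity and evaluating the quadratic form at
  a vector \<open>\<xi>\<close> shows that the image of \<open>x\<close> maps \<open>\<xi>\<close> to a vector no longer than \<open>\<xi>\<close>. The square root
  is a fixed point of a contraction on a complete set of self-adjoint elements
  (lemma \<open>square_root_in_Cred\<close>).

  Consequently \<open>M t\<close> agrees on the whole algebra with conjugation by the phases
  \<open>cis (t * b h)\<close>, which fix the vector \<open>delta 0\<close> because \<open>b 0 = 0\<close>; this gives the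
  formula. The Fourier coefficients of \<open>Sb b y\<^sub>0\<close> and \<open>Tb b y\<^sub>0\<close> are the coefficients of their
  defining series, and the theorem follows from the Euler formulas for cosine and sine.
\<close>

section \<open>Adjoints\<close>

lemma Re_cinner: "Re (cinner x y) = inner x y"
  by (simp add: inner_ell2_def)

lemma Im_cinner: "Im (cinner x y) = inner (cscale (- \<i>) x) y"
  by (simp add: inner_ell2_def cinner_cscale_left)

lemma cinner_add_right: "cinner x (y + z) = cinner x y + cinner x z"
  by (metis cinner_add_left cinner_cnj complex_cnj_add)

lemma cinner_cscale_right: "cinner x (cscale c y) = cnj c * cinner x y"
  by (metis cinner_cscale_left cinner_cnj complex_cnj_mult)

lemma cinner_zero_left: "cinner 0 y = 0"
  by (simp add: cinner_def)

lemma cinner_zero_right: "cinner x 0 = 0"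
  by (simp add: cinner_def)

text \<open>
  Expressing the imaginary part through the real inner product reduces this to the continuity
  of the latter.
\<close>
lemma tendsto_cinner:
  assumes "(X \<longlongrightarrow> x) F" and "(Y \<longlongrightarrow> y) F"
  shows "((\<lambda>n. cinner (X n) (Y n)) \<longlongrightarrow> cinner x y) F"
proof -
  have "((\<lambda>n. cscale (- \<i>) (X n)) \<longlongrightarrow> cscale (- \<i>) x) F"
    by (rule bounded_linear.tendsto[OF bounded_linear_cscale assms(1)])
  then show ?thesis
    unfolding tendsto_complex_iff Re_cinner Im_cinner using assms by (intro conjI tendsto_inner)
qed

lemma is_adjoint_sym: "is_adjoint x y \<Longrightarrow> is_adjoint y x"
  unfolding is_adjoint_def by (metis cinner_cnj)

lemma is_adjoint_zero: "is_adjoint 0 0"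
  by (simp add: is_adjoint_def cinner_zero_left cinner_zero_right)

lemma is_adjoint_id: "is_adjoint id_blinfun id_blinfun"
  by (simp add: is_adjoint_def)

lemma is_adjoint_add:
  "is_adjoint x y \<Longrightarrow> is_adjoint x' y' \<Longrightarrow> is_adjoint (x + x') (y + y')"
  by (simp add: is_adjoint_def blinfun.add_left cinner_add_left cinner_add_right)

lemma is_adjoint_op_scale:
  "is_adjoint x y \<Longrightarrow> is_adjoint (op_scale c x) (op_scale (cnj c) y)"
  by (simp add: is_adjoint_def cinner_cscale_left cinner_cscale_right)

lemma scaleR_eq_op_scale: "r *\<^sub>R x = op_scale (of_real r) x"
  by (intro blinfun_eqI ell2_eqI) (simp add: blinfun.scaleR_left)

lemma is_adjoint_scaleR: "is_adjoint x y \<Longrightarrow> is_adjoint (r *\<^sub>R x) (r *\<^sub>R y)"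
  unfolding scaleR_eq_op_scale using is_adjoint_op_scale[of x y "of_real r"] by simp

lemma is_adjoint_diff:
  assumes "is_adjoint x y" "is_adjoint x' y'"
  shows "is_adjoint (x - x') (y - y')"
  using is_adjoint_add[OF assms(1) is_adjoint_scaleR[OF assms(2), of "- 1"]] by simp

lemma is_adjoint_compose:
  "is_adjoint x y \<Longrightarrow> is_adjoint x' y' \<Longrightarrow> is_adjoint (x o\<^sub>L x') (y' o\<^sub>L y)"
  by (simp add: is_adjoint_def)

lemma is_adjoint_inner: "is_adjoint x y \<Longrightarrow> inner (x \<xi>) \<eta> = inner \<xi> (y \<eta>)"
  by (simp add: is_adjoint_def inner_ell2_def)

text \<open>
  Cauchy-Schwarz applied to \<open>(norm (y \<eta>))\<^sup>2 = inner (x (y \<eta>)) \<eta>\<close>, then division by \<open>norm (y \<eta>)\<close>.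
\<close>
lemma norm_adjoint_le:
  assumes "is_adjoint x y"
  shows "norm y \<le> norm x"
proof (rule norm_blinfun_bound)
  fix \<eta>
  have "norm (y \<eta>) * norm (y \<eta>) = inner (x (y \<eta>)) \<eta>"
    using is_adjoint_inner[OF assms, of "y \<eta>" \<eta>] by (simp add: power2_norm_eq_inner flip: power2_eq_square)
  also have "\<dots> \<le> norm (x (y \<eta>)) * norm \<eta>"
    by (rule norm_cauchy_schwarz)
  also have "\<dots> \<le> (norm x * norm (y \<eta>)) * norm \<eta>"
    by (intro mult_right_mono norm_blinfun) simp
  finally have "norm (y \<eta>) * norm (y \<eta>) \<le> norm (y \<eta>) * (norm x * norm \<eta>)"
    by (simp add: mult_ac)
  then show "norm (y \<eta>) \<le> norm x * norm \<eta>"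
    by (cases "norm (y \<eta>) = 0") (auto simp: mult_le_cancel_left_pos)
qed simp

lemma is_adjoint_tendsto:
  assumes "X \<longlonglongrightarrow> x" and "Y \<longlonglongrightarrow> y" and adj: "\<And>n. is_adjoint (X n) (Y n)"
  shows "is_adjoint x y"
  unfolding is_adjoint_def
proof (intro allI)
  fix \<xi> \<eta>
  have X: "(\<lambda>n. X n \<xi>) \<longlonglongrightarrow> x \<xi>" and Y: "(\<lambda>n. Y n \<eta>) \<longlonglongrightarrow> y \<eta>"
    using assms by (auto intro: blinfun.tendsto)
  have "(\<lambda>n. cinner (X n \<xi>) \<eta>) \<longlonglongrightarrow> cinner \<xi> (y \<eta>)"
    using tendsto_cinner[OF tendsto_const Y, of \<xi>] adj by (simp add: is_adjoint_def)
  then show "cinner (x \<xi>) \<eta> = cinner \<xi> (y \<eta>)"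
    using tendsto_cinner[OF X tendsto_const, of \<eta>] LIMSEQ_unique by blast
qed


section \<open>The reduced group C*-algebra is a unital *-algebra\<close>

lemma bounded_linear_op_scale: "bounded_linear (op_scale c)"
proof (rule bounded_linear_intro[where K = "cmod c"])
  fix x :: "'g ell2 \<Rightarrow>\<^sub>L 'g ell2"
  have "norm (cscale c (x \<xi>)) \<le> norm x * cmod c * norm \<xi>" for \<xi>
    using mult_left_mono[OF norm_blinfun[of x \<xi>], of "cmod c"] by (simp add: norm_cscale mult_ac)
  then show "norm (op_scale c x) \<le> norm x * cmod c"
    by (intro norm_blinfun_bound) auto
qed (auto intro!: blinfun_eqI ell2_eqI
      simp: blinfun.add_left blinfun.scaleR_left algebra_simps)

lemma lreg_zero: "lreg 0 = id_blinfun"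
  by (intro blinfun_eqI ell2_eqI) simp

lemma lreg_compose: "lreg g o\<^sub>L lreg h = lreg (g + h)"
  by (intro blinfun_eqI ell2_eqI) (simp add: minus_add add.assoc[symmetric] del: add_uminus_conv_diff)

lemma is_adjoint_lreg: "is_adjoint (lreg g) (lreg (- g))"
  unfolding is_adjoint_def cinner_def
proof (intro allI)
  fix \<xi> \<eta> :: "'a ell2"
  have "bij_betw (\<lambda>h. g + h) UNIV UNIV"
    by (rule bij_betwI[where g = "\<lambda>h. - g + h"]) (auto simp: add.assoc[symmetric])
  from infsum_reindex_bij_betw[OF this,
      of "\<lambda>h. ell2_apply (lreg g \<xi>) h * cnj (ell2_apply \<eta> h)"]
  show "(\<Sum>\<^sub>\<infinity>h. ell2_apply (lreg g \<xi>) h * cnj (ell2_apply \<eta> h))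
      = (\<Sum>\<^sub>\<infinity>h. ell2_apply \<xi> h * cnj (ell2_apply (lreg (- g) \<eta>) h))"
    by (simp add: add.assoc[symmetric])
qed

lemma op_span_compose:
  assumes "x \<in> op_span (range lreg)" "y \<in> op_span (range lreg)"
  shows "x o\<^sub>L y \<in> op_span (range lreg)"
  using assms(1)
proof (induction x rule: ell2_op.span_induct_alt)
  case base
  have "0 o\<^sub>L y = 0" by (intro blinfun_eqI) simp
  then show ?case by (simp add: ell2_op.span_zero)
next
  case (step c x z)
  then obtain g where g: "x = lreg g" by auto
  have "lreg g o\<^sub>L y \<in> op_span (range lreg)"
    using assms(2)
  proof (induction y rule: ell2_op.span_induct_alt)
    case base
    have "lreg g o\<^sub>L 0 = 0" by (intro blinfun_eqI) simp
    then show ?case by (simp add: ell2_op.span_zero)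
  next
    case (step d w v)
    then obtain h where h: "w = lreg h" by auto
    have "lreg g o\<^sub>L (op_scale d w + v) = op_scale d (lreg (g + h)) + (lreg g o\<^sub>L v)"
      unfolding h lreg_compose[symmetric]
      by (intro blinfun_eqI ell2_eqI) (simp add: blinfun.add_left blinfun.add_right)
    moreover have "lreg (g + h) \<in> op_span (range lreg)"
      by (rule ell2_op.span_base) simp
    ultimately show ?case
      using step by (simp add: ell2_op.span_add ell2_op.span_scale)
  qed
  moreover have "(op_scale c x + z) o\<^sub>L y = op_scale c (lreg g o\<^sub>L y) + (z o\<^sub>L y)"
    unfolding g by (intro blinfun_eqI ell2_eqI) (simp add: blinfun.add_left)
  ultimately show ?case
    using step by (auto intro!: ell2_op.span_add ell2_op.span_scale)
qed

lemma closed_Cred: "closed Cred"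
  by (simp add: Cred_def)

lemma Cred_approx:
  assumes "x \<in> Cred"
  obtains X where "\<And>n. X n \<in> op_span (range lreg)" "X \<longlonglongrightarrow> x"
  using assms unfolding Cred_def closure_sequential by blast

lemma op_span_subset_Cred: "op_span (range lreg) \<subseteq> Cred"
  by (simp add: Cred_def closure_subset)

lemma Cred_limit: "X \<longlonglongrightarrow> x \<Longrightarrow> (\<And>n. X n \<in> Cred) \<Longrightarrow> x \<in> Cred"
  using closed_Cred closed_sequentially by blast

lemma lreg_in_Cred: "lreg g \<in> Cred"
  using op_span_subset_Cred ell2_op.span_base by blast

lemma id_in_Cred: "id_blinfun \<in> Cred"
  using lreg_in_Cred[of 0] by (simp add: lreg_zero)

lemma Cred_add:
  assumes "x \<in> Cred" "y \<in> Cred" shows "x + y \<in> Cred"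
proof -
  obtain X where X: "\<And>n. X n \<in> op_span (range lreg)" "X \<longlonglongrightarrow> x" using Cred_approx assms(1) by blast
  obtain Y where Y: "\<And>n. Y n \<in> op_span (range lreg)" "Y \<longlonglongrightarrow> y" using Cred_approx assms(2) by blast
  show ?thesis
    by (rule Cred_limit[OF tendsto_add[OF X(2) Y(2)]])
      (use X(1) Y(1) op_span_subset_Cred ell2_op.span_add in blast)
qed

lemma Cred_op_scale:
  assumes "x \<in> Cred" shows "op_scale c x \<in> Cred"
proof -
  obtain X where X: "\<And>n. X n \<in> op_span (range lreg)" "X \<longlonglongrightarrow> x" using Cred_approx assms by blast
  show ?thesis
    by (rule Cred_limit[OF bounded_linear.tendsto[OF bounded_linear_op_scale X(2)]])
      (use X(1) op_span_subset_Cred ell2_op.span_scale in blast)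
qed

lemma Cred_scaleR: "x \<in> Cred \<Longrightarrow> r *\<^sub>R x \<in> Cred"
  by (simp add: scaleR_eq_op_scale Cred_op_scale)

lemma Cred_diff:
  assumes "x \<in> Cred" "y \<in> Cred" shows "x - y \<in> Cred"
  using Cred_add[OF assms(1) Cred_scaleR[OF assms(2), of "- 1"]] by simp

lemma Cred_compose:
  assumes "x \<in> Cred" "y \<in> Cred" shows "x o\<^sub>L y \<in> Cred"
proof -
  obtain X where X: "\<And>n. X n \<in> op_span (range lreg)" "X \<longlonglongrightarrow> x" using Cred_approx assms(1) by blast
  obtain Y where Y: "\<And>n. Y n \<in> op_span (range lreg)" "Y \<longlonglongrightarrow> y" using Cred_approx assms(2) by blast
  have "(\<lambda>n. X n o\<^sub>L Y n) \<longlonglongrightarrow> (x o\<^sub>L y)"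
    by (rule bounded_bilinear.tendsto[OF bounded_bilinear_blinfun_compose X(2) Y(2)])
  then show ?thesis
    by (rule Cred_limit) (use X(1) Y(1) op_span_subset_Cred op_span_compose in blast)
qed

lemma op_span_adjoint_exists:
  assumes "x \<in> op_span (range lreg)"
  shows "\<exists>y\<in>op_span (range lreg). is_adjoint x y"
  using assms
proof (induction x rule: ell2_op.span_induct_alt)
  case base
  then show ?case using is_adjoint_zero ell2_op.span_zero by blast
next
  case (step c x z)
  then obtain g w where g: "x = lreg g" and w: "w \<in> op_span (range lreg)" "is_adjoint z w" by auto
  have "is_adjoint (op_scale c x + z) (op_scale (cnj c) (lreg (- g)) + w)"
    unfolding g by (intro is_adjoint_add is_adjoint_op_scale is_adjoint_lreg w)
  moreover have "op_scale (cnj c) (lreg (- g)) + w \<in> op_span (range lreg)"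
    by (intro ell2_op.span_add ell2_op.span_scale w) (auto intro: ell2_op.span_base)
  ultimately show ?case by blast
qed

text \<open>
  Taking adjoints does not increase the norm, so the adjoints of a convergent sequence form a
  Cauchy sequence; its limit is the adjoint of the limit.
\<close>
lemma Cred_adjoint_exists:
  assumes "x \<in> Cred"
  shows "\<exists>y\<in>Cred. is_adjoint x y"
proof -
  obtain X where X: "\<And>n. X n \<in> op_span (range lreg)" "X \<longlonglongrightarrow> x" using Cred_approx assms by blast
  obtain Y where Y: "\<And>n. Y n \<in> op_span (range lreg)" "\<And>n. is_adjoint (X n) (Y n)"
    using op_span_adjoint_exists[OF X(1)] by metis
  have "Cauchy Y"
  proof (rule CauchyI)
    fix e :: real assume "e > 0"
    then obtain N where "\<forall>m\<ge>N. \<forall>n\<ge>N. norm (X m - X n) < e"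
      using CauchyD[OF LIMSEQ_imp_Cauchy[OF X(2)]] by blast
    moreover have "norm (Y m - Y n) \<le> norm (X m - X n)" for m n
      by (intro norm_adjoint_le is_adjoint_diff Y(2))
    ultimately show "\<exists>N. \<forall>m\<ge>N. \<forall>n\<ge>N. norm (Y m - Y n) < e"
      by (meson order_le_less_trans)
  qed
  then obtain y where y: "Y \<longlonglongrightarrow> y" by (auto simp: Cauchy_convergent_iff convergent_def)
  have "y \<in> Cred" by (rule Cred_limit[OF y]) (use Y(1) op_span_subset_Cred in blast)
  then show ?thesis using is_adjoint_tendsto[OF X(2) y Y(2)] by blast
qed


section \<open>Automatic contractivity of *-automorphisms\<close>

text \<open>
  Writing the square root as \<open>1 - z\<close> turns \<open>(1 - z)\<^sup>2 = 1 - a\<close> into the fixed point equation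
  \<open>z = (a + z\<^sup>2) / 2\<close>. With \<open>r = norm a\<close>, the right-hand side maps the ball of radius \<open>r\<close> to
  itself because \<open>(r + r\<^sup>2) / 2 \<le> r\<close>, and it is \<open>r\<close>-Lipschitz there because
  \<open>z\<^sup>2 - w\<^sup>2 = z (z - w) + (z - w) w\<close>. It preserves self-adjointness, so the fixed point is
  self-adjoint.
\<close>
lemma square_root_in_Cred:
  fixes a :: "'g::group_add ell2 \<Rightarrow>\<^sub>L 'g ell2"
  assumes a: "a \<in> Cred" "is_adjoint a a" "norm a < 1"
  shows "\<exists>k\<in>Cred. is_adjoint k k \<and> k o\<^sub>L k = id_blinfun - a"
proof -
  define f where "f z = (1 / 2) *\<^sub>R (a + (z o\<^sub>L z))" for z
  define S where "S = {z :: 'g ell2 \<Rightarrow>\<^sub>L 'g ell2. z \<in> Cred \<and> is_adjoint z z \<and> norm z \<le> norm a}"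
  have "complete S"
    unfolding complete_eq_closed closed_sequential_limits
  proof (intro allI impI, elim conjE)
    fix Z z assume Z: "\<forall>n. Z n \<in> S" "Z \<longlonglongrightarrow> z"
    have "z \<in> Cred" by (rule Cred_limit[OF Z(2)]) (use Z(1) in \<open>simp add: S_def\<close>)
    moreover have "is_adjoint z z"
      by (rule is_adjoint_tendsto[OF Z(2) Z(2)]) (use Z(1) in \<open>simp add: S_def\<close>)
    moreover have "norm z \<le> norm a"
      by (rule Lim_norm_ubound[OF _ Z(2)]) (use Z(1) in \<open>simp_all add: S_def\<close>)
    ultimately show "z \<in> S" by (simp add: S_def)
  qed
  moreover have "S \<noteq> {}"
    using a by (auto simp: S_def)
  moreover have "f ` S \<subseteq> S"
  proof clarify
    fix z assume z: "z \<in> S"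
    have "norm (z o\<^sub>L z) \<le> norm z * norm z" by (rule norm_blinfun_compose)
    also have "\<dots> \<le> norm a * 1" using z a(3) by (intro mult_mono) (auto simp: S_def)
    finally have "norm (a + (z o\<^sub>L z)) \<le> 2 * norm a"
      using norm_triangle_ineq[of a "z o\<^sub>L z"] by simp
    then show "f z \<in> S"
      using z a unfolding S_def f_def
      by (auto intro!: Cred_scaleR Cred_add Cred_compose is_adjoint_scaleR is_adjoint_add
          is_adjoint_compose)
  qed
  moreover have "\<forall>z\<in>S. \<forall>w\<in>S. dist (f z) (f w) \<le> norm a * dist z w"
  proof clarify
    fix z w assume zw: "z \<in> S" "w \<in> S"
    have "f z - f w = (1 / 2) *\<^sub>R ((z o\<^sub>L (z - w)) + ((z - w) o\<^sub>L w))"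
      unfolding f_def
      by (intro blinfun_eqI) (simp add: blinfun.bilinear_simps algebra_simps)
    then have "dist (f z) (f w) = norm ((z o\<^sub>L (z - w)) + ((z - w) o\<^sub>L w)) / 2"
      by (simp add: dist_norm)
    also have "\<dots> \<le> (norm z * norm (z - w) + norm (z - w) * norm w) / 2"
      by (intro divide_right_mono norm_triangle_mono norm_blinfun_compose) simp
    also have "\<dots> \<le> (norm a * norm (z - w) + norm (z - w) * norm a) / 2"
      using zw by (intro divide_right_mono add_mono mult_mono) (auto simp: S_def)
    finally show "dist (f z) (f w) \<le> norm a * dist z w"
      by (simp add: dist_norm mult.commute)
  qed
  ultimately obtain z where z: "z \<in> S" "f z = z"
    using Banach_fix[of S "norm a" f] a(3) by auto
  have "(2::real) *\<^sub>R f z = a + (z o\<^sub>L z)" by (simp add: f_def)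
  then have zz: "z o\<^sub>L z = (2::real) *\<^sub>R z - a" by (simp add: z)
  have "(id_blinfun - z) o\<^sub>L (id_blinfun - z) = id_blinfun - (2::real) *\<^sub>R z + (z o\<^sub>L z)"
    by (intro blinfun_eqI) (simp add: blinfun.bilinear_simps scaleR_2)
  also have "\<dots> = id_blinfun - a" by (simp add: zz)
  finally show ?thesis
    using z(1) by (intro bexI[of _ "id_blinfun - z"] conjI is_adjoint_diff is_adjoint_id Cred_diff
        id_in_Cred) (auto simp: S_def)
qed

text \<open>
  Since \<open>\<phi>\<close> is onto, some \<open>y\<close> is mapped to the identity, and \<open>\<phi> 1 = \<phi> 1 \<phi> y = \<phi> (1 y) = \<phi> y = 1\<close>.
\<close>
lemma star_automorphism_id:
  assumes "star_automorphism \<phi>"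
  shows "\<phi> id_blinfun = id_blinfun"
proof -
  obtain y where y: "y \<in> Cred" "\<phi> y = id_blinfun"
    using assms id_in_Cred unfolding star_automorphism_def bij_betw_def by (metis imageE)
  have "\<phi> (id_blinfun o\<^sub>L y) = \<phi> id_blinfun o\<^sub>L \<phi> y"
    using assms y(1) id_in_Cred unfolding star_automorphism_def by blast
  moreover have "id_blinfun o\<^sub>L y = y" "\<phi> id_blinfun o\<^sub>L id_blinfun = \<phi> id_blinfun"
    by (simp_all add: blinfun_eqI)
  ultimately show ?thesis using y(2) by simp
qed

text \<open>
  The bound on \<open>norm x\<close> makes \<open>1 - y x\<close> a square \<open>k\<^sup>2\<close> with \<open>k\<close> self-adjoint, where \<open>y\<close> is the
  adjoint of \<open>x\<close>. The identity \<open>y x + k\<^sup>2 = 1\<close> is preserved by \<open>\<phi>\<close>, and its quadratic form gives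
  \<open>(norm (\<phi> x \<xi>))\<^sup>2 + (norm (\<phi> k \<xi>))\<^sup>2 = (norm \<xi>)\<^sup>2\<close>.
\<close>
lemma star_automorphism_unit_ball:
  assumes \<phi>: "star_automorphism \<phi>" and x: "x \<in> Cred" "norm x < 1"
  shows "norm (\<phi> x) \<le> 1"
proof -
  obtain y where y: "y \<in> Cred" "is_adjoint x y" using Cred_adjoint_exists x(1) by blast
  have "norm (y o\<^sub>L x) \<le> norm y * norm x" by (rule norm_blinfun_compose)
  also have "\<dots> \<le> norm x * norm x" by (intro mult_right_mono norm_adjoint_le y) simp
  also have "\<dots> < 1" using x(2) mult_strict_mono[of "norm x" 1 "norm x" 1] by simp
  finally have "norm (y o\<^sub>L x) < 1" .
  then obtain k where k: "k \<in> Cred" "is_adjoint k k" "k o\<^sub>L k = id_blinfun - (y o\<^sub>L x)"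
    using square_root_in_Cred[of "y o\<^sub>L x"] x y Cred_compose is_adjoint_compose is_adjoint_sym by blast
  then have "(y o\<^sub>L x) + (k o\<^sub>L k) = id_blinfun" by simp
  moreover have "\<phi> ((y o\<^sub>L x) + (k o\<^sub>L k)) = (\<phi> y o\<^sub>L \<phi> x) + (\<phi> k o\<^sub>L \<phi> k)"
    using \<phi> x(1) y(1) k(1) by (simp add: star_automorphism_def Cred_compose)
  ultimately have sum: "(\<phi> y o\<^sub>L \<phi> x) + (\<phi> k o\<^sub>L \<phi> k) = id_blinfun"
    by (simp add: star_automorphism_id[OF \<phi>])
  have adj: "is_adjoint (\<phi> x) (\<phi> y)" "is_adjoint (\<phi> k) (\<phi> k)"
    using \<phi> x(1) y k by (auto simp: star_automorphism_def)
  show ?thesis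
  proof (rule norm_blinfun_bound)
    fix \<xi>
    have "(norm (\<phi> x \<xi>))\<^sup>2 + (norm (\<phi> k \<xi>))\<^sup>2 = inner \<xi> (\<phi> y (\<phi> x \<xi>)) + inner \<xi> (\<phi> k (\<phi> k \<xi>))"
      by (simp add: power2_norm_eq_inner is_adjoint_inner[OF adj(1)] is_adjoint_inner[OF adj(2)])
    also have "\<dots> = inner \<xi> (((\<phi> y o\<^sub>L \<phi> x) + (\<phi> k o\<^sub>L \<phi> k)) \<xi>)"
      by (simp add: blinfun.add_left inner_add_right)
    also have "\<dots> = (norm \<xi>)\<^sup>2" by (simp add: sum power2_norm_eq_inner)
    finally have "(norm (\<phi> x \<xi>))\<^sup>2 \<le> (norm \<xi>)\<^sup>2" using zero_le_power2[of "norm (\<phi> k \<xi>)"] by linarith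
    then show "norm (\<phi> x \<xi>) \<le> 1 * norm \<xi>" by (simp add: power2_le_iff_abs_le)
  qed simp
qed

text \<open>
  Dividing by \<open>norm x + e\<close> rather than by \<open>norm x\<close> brings \<open>x\<close> into the open unit ball and covers
  \<open>x = 0\<close> as well.
\<close>
lemma star_automorphism_norm_le:
  assumes \<phi>: "star_automorphism \<phi>" and x: "x \<in> Cred"
  shows "norm (\<phi> x) \<le> norm x"
proof (rule field_le_epsilon)
  fix e :: real assume e: "e > 0"
  define r where "r = norm x + e"
  have r: "r > 0" "norm x < r" using e by (auto simp: r_def add_nonneg_pos)
  have "norm (\<phi> (inverse r *\<^sub>R x)) \<le> 1"
    using r by (intro star_automorphism_unit_ball[OF \<phi>] Cred_scaleR x) (simp add: field_simps)
  moreover have "\<phi> (inverse r *\<^sub>R x) = inverse r *\<^sub>R \<phi> x"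
    using \<phi> x unfolding scaleR_eq_op_scale star_automorphism_def by blast
  ultimately have "norm (\<phi> x) \<le> r"
    using r(1) by (simp add: field_simps)
  then show "norm (\<phi> x) \<le> norm x + e" by (simp add: r_def)
qed

lemma star_automorphism_diff:
  assumes \<phi>: "star_automorphism \<phi>" and xy: "x \<in> Cred" "y \<in> Cred"
  shows "\<phi> (x - y) = \<phi> x - \<phi> y"
proof -
  have "\<phi> ((x - y) + y) = \<phi> (x - y) + \<phi> y"
    using \<phi> xy Cred_diff unfolding star_automorphism_def by blast
  then show ?thesis by (simp add: algebra_simps)
qed

lemma star_automorphism_tendsto:
  assumes \<phi>: "star_automorphism \<phi>" and X: "X \<longlonglongrightarrow> x" "\<And>n. X n \<in> Cred" and x: "x \<in> Cred"
  shows "(\<lambda>n. \<phi> (X n)) \<longlonglongrightarrow> \<phi> x"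
proof (rule LIMSEQ_I)
  fix e :: real assume "e > 0"
  then obtain N where "\<forall>n\<ge>N. norm (X n - x) < e" using LIMSEQ_D[OF X(1)] by blast
  moreover have "norm (\<phi> (X n) - \<phi> x) \<le> norm (X n - x)" for n
    using star_automorphism_norm_le[OF \<phi> Cred_diff[OF X(2) x]]
    by (simp add: star_automorphism_diff[OF \<phi> X(2) x])
  ultimately show "\<exists>N. \<forall>n\<ge>N. norm (\<phi> (X n) - \<phi> x) < e" by (meson order_le_less_trans)
qed


section \<open>The flow is conjugation by phases\<close>

lemma flow_eq_conj_flow_on_span:
  assumes hom: "\<forall>g h. b (g + h) = b g + b h" and M: "is_flow b M"
    and x: "x \<in> op_span (range lreg)"
  shows "M t x = conj_flow b t x"
proof -
  have st: "star_automorphism (M t)" using M by (simp add: is_flow_def)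
  have "x \<in> op_span (range lreg) \<and> M t x = conj_flow b t x"
    using x
  proof (induction x rule: ell2_op.span_induct_alt)
    case base
    have "M t 0 = 0"
      using star_automorphism_diff[OF st id_in_Cred id_in_Cred] by simp
    moreover have "conj_flow b t 0 = 0"
      by (rule bounded_linear.linear[OF bounded_linear_conj_flow, THEN linear_0])
    ultimately show ?case by (simp add: ell2_op.span_zero)
  next
    case (step c x y)
    then obtain g where g: "x = lreg g" by auto
    have y: "y \<in> Cred" using step op_span_subset_Cred by blast
    have "M t (op_scale c x + y) = op_scale c (M t (lreg g)) + M t y"
      using st y unfolding g star_automorphism_def by (simp add: Cred_op_scale lreg_in_Cred)
    also have "M t (lreg g) = conj_flow b t (lreg g)"
      using M by (simp add: is_flow_def conj_flow_lreg[OF hom])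
    finally have "M t (op_scale c x + y) = conj_flow b t (op_scale c x + y)"
      using step by (simp add: g conj_flow_add conj_flow_scale)
    moreover have "lreg g \<in> op_span (range lreg)"
      by (rule ell2_op.span_base) simp
    ultimately show ?case
      using step by (simp add: g ell2_op.span_add ell2_op.span_scale)
  qed
  then show ?thesis by blast
qed

lemma flow_eq_conj_flow:
  assumes hom: "\<forall>g h. b (g + h) = b g + b h" and M: "is_flow b M" and x: "x \<in> Cred"
  shows "M t x = conj_flow b t x"
proof -
  obtain X where X: "\<And>n. X n \<in> op_span (range lreg)" "X \<longlonglongrightarrow> x" using Cred_approx x by blast
  have "star_automorphism (M t)" using M by (simp add: is_flow_def)
  then have "(\<lambda>n. M t (X n)) \<longlonglongrightarrow> M t x"
    by (rule star_automorphism_tendsto[OF _ X(2) _ x]) (use X(1) op_span_subset_Cred in blast)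
  then have "(\<lambda>n. conj_flow b t (X n)) \<longlonglongrightarrow> M t x"
    by (simp add: flow_eq_conj_flow_on_span[OF hom M X(1)])
  moreover have "(\<lambda>n. conj_flow b t (X n)) \<longlonglongrightarrow> conj_flow b t x"
    by (rule bounded_linear.tendsto[OF bounded_linear_conj_flow X(2)])
  ultimately show ?thesis by (rule LIMSEQ_unique)
qed


section \<open>Fourier coefficients\<close>

lemma fourier_add: "fourier (x + y) g = fourier x g + fourier y g"
  by (simp add: fourier_def blinfun.add_left)

lemma fourier_diff: "fourier (x - y) g = fourier x g - fourier y g"
  by (simp add: fourier_def blinfun.diff_left)

lemma fourier_op_scale: "fourier (op_scale c x) g = c * fourier x g"
  by (simp add: fourier_def)

lemma fourier_lreg: "fourier (lreg h) g = (if g = h then 1 else 0)"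
proof -
  have "- h + g = 0 \<longleftrightarrow> g = h" by (metis add.right_neutral add_minus_cancel left_minus)
  then show ?thesis by (simp add: fourier_def ell2_apply_delta)
qed

lemma bounded_linear_ell2_apply: "bounded_linear (\<lambda>x. ell2_apply x g)"
  by (rule bounded_linear_intro[where K = 1])
    (auto simp: ell2_apply_le_norm scaleR_conv_of_real)

lemma bounded_linear_fourier: "bounded_linear (\<lambda>x. fourier x g)"
  unfolding fourier_def
  by (rule bounded_linear_compose[OF bounded_linear_ell2_apply blinfun.bounded_linear_left])

text \<open>
  A Fourier coefficient is a bounded linear functional, so it can be taken term by term, and only
  the term with index \<open>g\<close> contributes.
\<close>
lemma fourier_lreg_series:
  assumes "(\<lambda>h. op_scale (c h) (lreg h)) summable_on S"
  shows "fourier (\<Sum>\<^sub>\<infinity>h\<in>S. op_scale (c h) (lreg h)) g = (if g \<in> S then c g else 0)"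
proof -
  have "fourier (\<Sum>\<^sub>\<infinity>h\<in>S. op_scale (c h) (lreg h)) g
      = (\<Sum>\<^sub>\<infinity>h\<in>S. fourier (op_scale (c h) (lreg h)) g)"
    using infsumI[OF has_sum_bounded_linear[OF bounded_linear_fourier has_sum_infsum[OF assms]]]
    by (simp add: o_def)
  also have "\<dots> = (\<Sum>\<^sub>\<infinity>h\<in>S \<inter> {g}. c h)"
    by (rule infsum_cong_neutral) (auto simp: fourier_op_scale fourier_lreg)
  also have "\<dots> = (if g \<in> S then c g else 0)" by simp
  finally show ?thesis .
qed

lemma fourier_Sb:
  assumes "x \<in> CF"
  shows "fourier (Sb b x) g = (if b g = 0 then fourier x g else 0)"
proof -
  have "(\<lambda>g. op_scale (fourier x g) (lreg g)) summable_on hom_kernel b"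
    by (rule summable_on_subset_banach[of _ UNIV]) (use assms in \<open>simp_all add: CF_def\<close>)
  then show ?thesis unfolding Sb_def by (simp add: fourier_lreg_series hom_kernel_def)
qed

lemma fourier_Tb:
  assumes "x \<in> Fspace 1 b"
  shows "fourier (Tb b x) g = (if b g = 0 then 0 else of_real (inverse (b g)) * fourier x g)"
proof -
  have "(\<lambda>g. op_scale (of_real (inverse (b g ^ 1)) * fourier x g) (lreg g))
      summable_on (UNIV - hom_kernel b)"
    using assms unfolding Fspace_def by blast
  then show ?thesis
    unfolding Tb_def by (subst fourier_lreg_series) (simp_all add: hom_kernel_def)
qed

text \<open>The vector \<open>delta 0\<close> is fixed by the phases because \<open>b 0 = 0\<close>.\<close>
lemma fourier_flow:
  assumes hom: "\<forall>g h. b (g + h) = b g + b h" and M: "is_flow b M" and x: "x \<in> Cred"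
  shows "fourier (M t x) g = cis (t * b g) * fourier x g"
proof -
  have "b 0 = 0" using hom[rule_format, of 0 0] by simp
  then have "modulate (\<lambda>g. - t * b g) (delta 0) = delta 0"
    by (intro ell2_eqI) (simp add: ell2_apply_delta)
  then show ?thesis
    by (simp add: flow_eq_conj_flow[OF hom M x] fourier_def conj_flow_apply)
qed

theorem proposition4p3:
  fixes b :: "'g::group_add \<Rightarrow> real"
    and M :: "real \<Rightarrow> ('g ell2 \<Rightarrow>\<^sub>L 'g ell2) \<Rightarrow> ('g ell2 \<Rightarrow>\<^sub>L 'g ell2)"
    and x\<^sub>0 y\<^sub>0 :: "'g ell2 \<Rightarrow>\<^sub>L 'g ell2"
    and u :: "real \<Rightarrow> ('g ell2 \<Rightarrow>\<^sub>L 'g ell2)"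
  assumes "countable (UNIV :: 'g set)" and "infinite (UNIV :: 'g set)"
    and "\<forall>g h. b (g + h) = b g + b h" and "\<exists>g. b g \<noteq> 0"
    and "is_flow b M"
    and "x\<^sub>0 \<in> Fspace 2 b" and "y\<^sub>0 \<in> Fspace 3 b"
    and "\<forall>t\<ge>0. u t = op_scale (of_real t) (Sb b y\<^sub>0)
           + op_scale (1 / 2) (M t x\<^sub>0 + M (- t) x\<^sub>0)
           + op_scale (1 / (2 * \<i>)) (M t (Tb b y\<^sub>0) - M (- t) (Tb b y\<^sub>0))"
    and "t \<ge> 0"
  shows "(g \<in> hom_kernel b \<longrightarrow>
            fourier (u t) g = fourier x\<^sub>0 g + of_real t * fourier y\<^sub>0 g) \<and>
         (g \<notin> hom_kernel b \<longrightarrow>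
            fourier (u t) g = of_real (cos (t * b g)) * fourier x\<^sub>0 g
              + of_real (sin (t * b g) / b g) * fourier y\<^sub>0 g)"
proof -
  note hom = assms(3) and M = assms(5)
  have x: "x\<^sub>0 \<in> Cred" using assms(6) by (simp add: Fspace_def)
  have y: "y\<^sub>0 \<in> CF" "y\<^sub>0 \<in> Fspace 1 b"
    using assms(7) Fspace_subset_CF Fspace_mono[of 1 3 b] by auto
  define T where "T = Tb b y\<^sub>0"
  have "fourier (u t) g = of_real t * fourier (Sb b y\<^sub>0) g
      + 1 / 2 * (fourier (M t x\<^sub>0) g + fourier (M (- t) x\<^sub>0) g)
      + 1 / (2 * \<i>) * (fourier (M t T) g - fourier (M (- t) T) g)"
    using assms(8)[rule_format, OF assms(9)]
    by (simp only: T_def fourier_add fourier_diff fourier_op_scale)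
  also have "\<dots> = of_real t * fourier (Sb b y\<^sub>0) g
      + 1 / 2 * (cis (t * b g) + cis (- (t * b g))) * fourier x\<^sub>0 g
      + 1 / (2 * \<i>) * (cis (t * b g) - cis (- (t * b g))) * fourier T g"
    using x Tb_in_Cred[of b y\<^sub>0]
    by (simp add: T_def fourier_flow[OF hom M] algebra_simps)
  also have "1 / 2 * (cis (t * b g) + cis (- (t * b g))) = of_real (cos (t * b g))"
    by (simp add: complex_eq_iff)
  also have "1 / (2 * \<i>) * (cis (t * b g) - cis (- (t * b g))) = of_real (sin (t * b g))"
    by (simp add: complex_eq_iff)
  finally show ?thesis
    by (cases "b g = 0")
      (simp_all add: T_def fourier_Sb[OF y(1)] fourier_Tb[OF y(2)] hom_kernel_def divide_inverse)
qed

end
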